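(* Let $\mathcal{F}=\{F_1(x,\bar z)=0,\ldots,F_N(x,\bar z)=0\}$, with $F_i\in\mathbb{F}_m(x)$, be a system of ordinary differential equations with radicals in the unknown functions $y_1,\ldots,y_\ell$ and their derivatives, let $\bar r(\bar w)\in\mathbb{C}(\bar w)^n$ be a rational change of variables, and let $\bar H(\bar z)\in\mathbb{F}_m^{\rho}$ be the tuple (in any order) of the non-rational coefficients of the $F_i(x,\bar z)$ with respect to $x$, i.e. of those coefficients that do not lie in $\mathbb{C}(\bar z)$. Let $\mathcal{G}$ be the transformed system $$\mathcal{G}=\begin{cases} G_1(x,\bar w)=0,\ \ldots,\ G_N(x,\bar w)=0,\\ r_{i,j+1}(\bar w)=J_{r_{i,j}}(\bar w)\cdot(\bar w')^T,\quad 1\le i\le \ell,\ 0\le j<n_i,\end{cases}$$ where $G_k(x,\bar w):=F_k(x,\bar r(\bar w))$. The following are equivalent. (1) $\mathcal{G}$ is a system of algebraic ordinary differential equations (AODEs). (2) All the components of $\bar H(\bar r(\bar w))$ are rational, i.e. lie in $\mathbb{C}(\bar w)$.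
   Context: Setting. Let $\bar z=(z_1,\ldots,z_n)$ be variables and let $\mathbb{F}_0=\mathbb{C}(\bar z)\subseteq\mathbb{F}_1\subseteq\cdots\subseteq\mathbb{F}_m$ be a radical tower: $\mathbb{F}_i=\mathbb{F}_{i-1}(\delta_i)$ with $\delta_i^{e_i}=\alpha_i\in\mathbb{F}_{i-1}$, $e_i\in\mathbb{N}$; put $\bar\delta=(\delta_1,\ldots,\delta_m)$. Let $n=n_1+\cdots+n_\ell+\ell$; the variables $z_1,\ldots,z_n$ stand, in this order, for $y_1,y_1',\ldots,y_1^{(n_1)},\ldots,y_\ell,\ldots,y_\ell^{(n_\ell)}$, where $y_1,\ldots,y_\ell$ are unknown functions of $x$. Thus $F_k(x,\bar z)=0$ stands for the differential equation $F_k(x,y_1,\ldots,y_\ell^{(n_\ell)})=0$. The $F_k\in\mathbb{F}_m(x)$ are assumed to have no denominators; in particular they are polynomials in $x$ with coefficients in $\mathbb{F}_m$. A rational change of variables is $\bar z=\bar r(\bar w)$, $\bar w=(w_1,\ldots,w_n)$, where $\bar r=(r_{1,0},\ldots,r_{1,n_1},\ldots,r_{\ell,0},\ldots,r_{\ell,n_\ell})\in\mathbb{C}(\bar w)^n$ has generically non-singular Jacobian; $r_{i,j}$ is the component replacing $y_i^{(j)}$. $J_{r_{i,j}}=(\partial r_{i,j}/\partial w_1,\ldots,\partial r_{i,j}/\partial w_n)$ and $\bar w'=(w_1',\ldots,w_n')$ are the derivatives with respect to $x$ of the new unknown functions $\bar w$. For $h\in\mathbb{F}_m$, $h(\bar r(\bar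 w))$ denotes the result of substituting $\bar z=\bar r(\bar w)$ in the radical function $h$ for a fixed suitable choice of branches, i.e. the image of $h$ under a fixed field homomorphism from $\mathbb{F}_m$ to an algebraic closure of $\mathbb{C}(\bar w)$ extending $z_i\mapsto$ ($i$-th component of $\bar r$). $F_k(x,\bar r(\bar w))$ is obtained by applying this to the coefficients of $F_k$. A system of AODEs here is one whose equations are, after clearing denominators, polynomial in the unknown functions and their derivatives, with coefficients rational in $x$; fractional expressions in $\bar w$ in the $G_k$ and the $r_{i,j}$ are allowed (one then considers numerators). *)

theory Defs
  imports
    "HOL-Library.Poly_Mapping"
    "HOL-Library.Nat_Bijection"
    "HOL-Computational_Algebra.Fraction_Field"
    "HOL-Computational_Algebra.Polynomial"
    "HOL-Algebra.Generated_Fields"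
    "HOL-Algebra.Algebraic_Closure_Type"
    "Jordan_Normal_Form.Determinant"
begin

section \<open>Rational functions over the complex numbers\<close>

type_synonym 'v mpol = "('v \<Rightarrow>\<^sub>0 nat) \<Rightarrow>\<^sub>0 complex"
type_synonym 'v ratfun = "'v mpol fract"

definition mpol_vars :: "'v mpol \<Rightarrow> 'v set" where
  "mpol_vars p = (\<Union>m\<in>Poly_Mapping.keys p. Poly_Mapping.keys m)"

definition rconst :: "complex \<Rightarrow> 'v::linorder ratfun" where
  "rconst c = Fract (Poly_Mapping.single 0 c) 1"

definition rvar :: "'v::linorder \<Rightarrow> 'v ratfun" where
  "rvar v = Fract (Poly_Mapping.single (Poly_Mapping.single v 1) 1) 1"

text \<open>The field \<open>\<complex>(V)\<close> of rational functions involving only the variables in \<open>V\<close>.\<close>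

definition ratfuns :: "'v::linorder set \<Rightarrow> 'v ratfun set" where
  "ratfuns V = {Fract p q | p q. q \<noteq> 0 \<and> mpol_vars p \<subseteq> V \<and> mpol_vars q \<subseteq> V}"

text \<open>
  Where the exponent of \<open>v\<close> in \<open>m\<close> is \<open>0\<close>, the truncated difference of exponents is harmless
  because the coefficient vanishes.
\<close>

definition mpol_pderiv :: "'v \<Rightarrow> 'v mpol \<Rightarrow> 'v mpol" where
  "mpol_pderiv v p = (\<Sum>m\<in>Poly_Mapping.keys p.
     Poly_Mapping.single (m - Poly_Mapping.single v 1)
       (of_nat (Poly_Mapping.lookup m v) * Poly_Mapping.lookup p m))"

lemma mpol_pderiv_superset:
  assumes "finite A" "Poly_Mapping.keys p \<subseteq> A"
  shows "mpol_pderiv v p = (\<Sum>m\<in>A. Poly_Mapping.single (m - Poly_Mapping.single v 1)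
           (of_nat (Poly_Mapping.lookup m v) * Poly_Mapping.lookup p m))"
  unfolding mpol_pderiv_def
  by (rule sum.mono_neutral_left) (use assms in \<open>auto simp: in_keys_iff\<close>)

lemma mpol_pderiv_add: "mpol_pderiv v (p + q) = mpol_pderiv v p + mpol_pderiv v q"
proof -
  let ?A = "Poly_Mapping.keys p \<union> Poly_Mapping.keys q"
  have "Poly_Mapping.keys (p + q) \<subseteq> ?A"
    by (rule Poly_Mapping.keys_add)
  then show ?thesis
    by (simp add: mpol_pderiv_superset[where A = ?A] lookup_add distrib_left single_add
        sum.distrib)
qed

lemma mpol_pderiv_0 [simp]: "mpol_pderiv v 0 = 0"
  by (simp add: mpol_pderiv_def)

lemma mpol_pderiv_sum: "mpol_pderiv v (\<Sum>i\<in>A. f i) = (\<Sum>i\<in>A. mpol_pderiv v (f i))"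
  by (induction A rule: infinite_finite_induct) (auto simp: mpol_pderiv_add)

lemma mpol_pderiv_single:
  "mpol_pderiv v (Poly_Mapping.single m c) =
     Poly_Mapping.single (m - Poly_Mapping.single v 1) (of_nat (Poly_Mapping.lookup m v) * c)"
  by (cases "c = 0") (auto simp: mpol_pderiv_def)

lemma mpol_as_sum: "(p :: 'v mpol) =
    (\<Sum>m\<in>Poly_Mapping.keys p. Poly_Mapping.single m (Poly_Mapping.lookup p m))"
  by (rule poly_mapping_eqI)
     (auto simp: lookup_sum lookup_single when_def in_keys_iff sum.delta[OF finite_keys])

lemma mpol_pderiv_mult_single:
  "mpol_pderiv v (Poly_Mapping.single m a * Poly_Mapping.single k b) =
     mpol_pderiv v (Poly_Mapping.single m a) * Poly_Mapping.single k b +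
     Poly_Mapping.single m a * mpol_pderiv v (Poly_Mapping.single k b)"
proof -
  let ?s = "Poly_Mapping.single v (1::nat)"
  have shift: "(x + y) - ?s = (x - ?s) + y"
    if "Poly_Mapping.lookup x v \<noteq> 0" for x y :: "'a \<Rightarrow>\<^sub>0 nat"
    using that by (intro poly_mapping_eqI) (auto simp: lookup_add lookup_minus lookup_single when_def)
  have l: "Poly_Mapping.single (m + k - ?s) (of_nat (Poly_Mapping.lookup m v) * (a * b)) =
      Poly_Mapping.single (m - ?s + k) (of_nat (Poly_Mapping.lookup m v) * (a * b))"
    using shift[of m k] by (cases "Poly_Mapping.lookup m v = 0") auto
  have r: "Poly_Mapping.single (m + k - ?s) (of_nat (Poly_Mapping.lookup k v) * (a * b)) =
      Poly_Mapping.single (m + (k - ?s)) (of_nat (Poly_Mapping.lookup k v) * (a * b))"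
    using shift[of k m] by (cases "Poly_Mapping.lookup k v = 0") (auto simp: add.commute)
  show ?thesis
    using l r
    by (simp add: mpol_pderiv_single mult_single lookup_add distrib_right single_add algebra_simps)
qed

lemma mpol_pderiv_mult:
  "mpol_pderiv v (p * q) = mpol_pderiv v p * q + p * mpol_pderiv v q"
proof -
  let ?s = "\<lambda>p m. Poly_Mapping.single m (Poly_Mapping.lookup p m)"
  let ?P = "Poly_Mapping.keys p" and ?Q = "Poly_Mapping.keys q"
  have "mpol_pderiv v ((\<Sum>m\<in>?P. ?s p m) * (\<Sum>k\<in>?Q. ?s q k)) =
      mpol_pderiv v (\<Sum>m\<in>?P. ?s p m) * (\<Sum>k\<in>?Q. ?s q k) +
      (\<Sum>m\<in>?P. ?s p m) * mpol_pderiv v (\<Sum>k\<in>?Q. ?s q k)"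
    by (simp add: sum_product mpol_pderiv_sum mpol_pderiv_mult_single sum.distrib)
  then show ?thesis
    by (simp flip: mpol_as_sum)
qed

text \<open>The partial derivative \<open>\<partial>f/\<partial>v\<close>, by the quotient rule; the lemma shows that the description
  does not depend on the chosen fraction.\<close>

definition ratfun_pderiv :: "'v::linorder \<Rightarrow> 'v ratfun \<Rightarrow> 'v ratfun" where
  "ratfun_pderiv v f = (THE d. \<exists>p q. q \<noteq> 0 \<and> f = Fract p q \<and>
     d = Fract (mpol_pderiv v p * q - p * mpol_pderiv v q) (q * q))"

lemma ratfun_pderiv_Fract:
  assumes "q \<noteq> 0"
  shows "ratfun_pderiv v (Fract p q) =
           Fract (mpol_pderiv v p * q - p * mpol_pderiv v q) (q * q)"
  unfolding ratfun_pderiv_def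
proof (rule the_equality)
  fix d assume "\<exists>p' q'. q' \<noteq> 0 \<and> Fract p q = Fract p' q' \<and>
      d = Fract (mpol_pderiv v p' * q' - p' * mpol_pderiv v q') (q' * q')"
  then obtain p' q' where nz: "q' \<noteq> 0" and "Fract p q = Fract p' q'"
    and d: "d = Fract (mpol_pderiv v p' * q' - p' * mpol_pderiv v q') (q' * q')"
    by blast
  then have eq: "p * q' = p' * q"
    using assms by (simp add: eq_fract)
  have deq: "mpol_pderiv v p * q' + p * mpol_pderiv v q' =
             mpol_pderiv v p' * q + p' * mpol_pderiv v q"
    using arg_cong[OF eq, of "mpol_pderiv v"] by (simp add: mpol_pderiv_mult)
  have "(mpol_pderiv v p' * q' - p' * mpol_pderiv v q') * (q * q) =
        (mpol_pderiv v p * q - p * mpol_pderiv v q) * (q' * q')"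
  proof -
    have "(mpol_pderiv v p' * q' - p' * mpol_pderiv v q') * (q * q) -
          (mpol_pderiv v p * q - p * mpol_pderiv v q) * (q' * q') =
          (q * q') * ((mpol_pderiv v p' * q + p' * mpol_pderiv v q) -
                      (mpol_pderiv v p * q' + p * mpol_pderiv v q')) +
          (p * q' - p' * q) * (q * mpol_pderiv v q' + q' * mpol_pderiv v q)"
      by (simp add: algebra_simps)
    then show ?thesis
      by (simp add: eq deq)
  qed
  then show "d = Fract (mpol_pderiv v p * q - p * mpol_pderiv v q) (q * q)"
    using nz assms by (simp add: d eq_fract)
qed (use assms in blast)


section \<open>Radical towers\<close>

definition subring_of_type :: "'a::ring_1 set \<Rightarrow> 'a ring" where
  "subring_of_type A = ring_of_type_algebra\<lparr>carrier := A\<rparr>"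

definition radical_tower ::
    "'k::field set \<Rightarrow> nat \<Rightarrow> (nat \<Rightarrow> 'k set) \<Rightarrow> (nat \<Rightarrow> 'k) \<Rightarrow> (nat \<Rightarrow> nat) \<Rightarrow> bool" where
  "radical_tower K m FF \<delta> e \<longleftrightarrow>
     FF 0 = K \<and>
     (\<forall>i\<in>{1..m}. e i \<ge> 1 \<and> \<delta> i ^ e i \<in> FF (i - 1) \<and>
        FF i = generate_field ring_of_type_algebra (FF (i - 1) \<union> {\<delta> i}))"

text \<open>Elements algebraic over \<open>K\<close>; in an algebraically closed field this is an
  algebraic closure of the subfield \<open>K\<close>.\<close>

definition algebraic_over :: "'a::field set \<Rightarrow> 'a set" where
  "algebraic_over K = {a. \<exists>p. p \<noteq> 0 \<and> (\<forall>i. Polynomial.coeff p i \<in> K) \<and> Polynomial.poly p a = 0}"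


section \<open>Algebraic ordinary differential equations\<close>

text \<open>
  Differential indeterminates: \<open>Indep\<close> is the independent variable \<open>x\<close>, and \<open>Unk k j\<close> is the
  \<open>j\<close>-th derivative of the \<open>k\<close>-th unknown \<open>w\<^sub>k\<close>, so that \<open>w\<^sub>k = Unk k 0\<close> and \<open>w\<^sub>k' = Unk k 1\<close>.
\<close>

datatype dvar = Indep | Unk nat nat

text \<open>The order carries no meaning; the library's integral domain instance for
  polynomials asks for a linear order on the variables.\<close>

fun dvar_code :: "dvar \<Rightarrow> nat" where
  "dvar_code Indep = 0"
| "dvar_code (Unk k j) = Suc (prod_encode (k, j))"

lemma dvar_code_inject: "dvar_code a = dvar_code b \<longleftrightarrow> a = b"
  by (cases a; cases b) auto

instantiation dvar :: linorder
begin
definition less_eq_dvar :: "dvar \<Rightarrow> dvar \<Rightarrow> bool" where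
  "less_eq_dvar a b \<longleftrightarrow> dvar_code a \<le> dvar_code b"
definition less_dvar :: "dvar \<Rightarrow> dvar \<Rightarrow> bool" where
  "less_dvar a b \<longleftrightarrow> dvar_code a < dvar_code b"
instance
  by standard (auto simp: less_eq_dvar_def less_dvar_def dvar_code_inject)
end

text \<open>
  Equations \<open>lhs = rhs\<close> whose two sides lie in an algebraic closure of the field
  \<open>\<complex>(x, w\<^sub>k\<^sup>(\<^sup>j\<^sup>) : k, j)\<close>, so that both radical and rational expressions in \<open>x\<close>, the unknowns
  and their derivatives are available.
\<close>

type_synonym dexpr = "dvar ratfun alg_closure"
type_synonym deqn = "dexpr \<times> dexpr"

definition unknowns :: "nat \<Rightarrow> dvar set" where
  "unknowns n = {Unk k 0 | k. k \<in> {1..n}}"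

definition unknowns_derivs :: "nat \<Rightarrow> dvar set" where
  "unknowns_derivs n = {Unk k j | k j. k \<in> {1..n}}"

text \<open>Polynomials in \<open>w\<^sub>1, \<dots>, w\<^sub>n\<close> and their derivatives with coefficients in \<open>\<complex>(x)\<close>;
  the coefficients are brought to a common denominator \<open>q\<close>.\<close>

definition diff_polys :: "nat \<Rightarrow> dvar ratfun set" where
  "diff_polys n = {Fract p q | p q. q \<noteq> 0 \<and>
     mpol_vars p \<subseteq> {Indep} \<union> unknowns_derivs n \<and> mpol_vars q \<subseteq> {Indep}}"

text \<open>The denominator \<open>d\<close> to be cleared has to be a differential polynomial itself: fractional
  expressions are allowed in an AODE, but denominators containing radicals are not.\<close>

definition is_AODE :: "nat \<Rightarrow> deqn \<Rightarrow> bool" where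
  "is_AODE n E \<longleftrightarrow>
     (\<exists>d\<in>diff_polys n. d \<noteq> 0 \<and> to_ac d * (fst E - snd E) \<in> to_ac ` diff_polys n)"

definition is_AODE_system :: "nat \<Rightarrow> deqn set \<Rightarrow> bool" where
  "is_AODE_system n S \<longleftrightarrow> (\<forall>E\<in>S. is_AODE n E)"


section \<open>The transformed system\<close>

text \<open>\<open>r 1, \<dots>, r n\<close> are the components of the change of variables in the order of
  \<open>z\<^sub>1, \<dots>, z\<^sub>n\<close>; library matrices are indexed from \<open>0\<close>.\<close>

definition jacobian :: "nat \<Rightarrow> (nat \<Rightarrow> dvar ratfun) \<Rightarrow> dvar ratfun mat" where
  "jacobian n r = mat n n (\<lambda>(p, q). ratfun_pderiv (Unk (Suc q) 0) (r (Suc p)))"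

definition rational_change :: "nat \<Rightarrow> (nat \<Rightarrow> dvar ratfun) \<Rightarrow> bool" where
  "rational_change n r \<longleftrightarrow> (\<forall>p\<in>{1..n}. r p \<in> ratfuns (unknowns n)) \<and> det (jacobian n r) \<noteq> 0"

text \<open>The index of the variable \<open>z\<close> standing for \<open>y\<^sub>i\<^sup>(\<^sup>j\<^sup>)\<close>, where \<open>y\<^sub>i\<close> occurs up to order \<open>\<nu> i\<close>
  and the variables are listed as \<open>y\<^sub>1, y\<^sub>1', \<dots>, y\<^sub>1\<^sup>(\<^sup>\<nu>\<^sup>1\<^sup>), y\<^sub>2, \<dots>\<close>, counting from \<open>1\<close>.\<close>

definition zpos :: "(nat \<Rightarrow> nat) \<Rightarrow> nat \<Rightarrow> nat \<Rightarrow> nat" where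
  "zpos \<nu> i j = (\<Sum>k\<in>{1..<i}. \<nu> k + 1) + j + 1"

definition transformed_eqn :: "('k::field \<Rightarrow> dexpr) \<Rightarrow> 'k poly \<Rightarrow> dexpr" where
  "transformed_eqn \<sigma> f = Polynomial.poly (map_poly \<sigma> f) (to_ac (rvar Indep))"

definition chain_rule_rhs :: "nat \<Rightarrow> dvar ratfun \<Rightarrow> dvar ratfun" where
  "chain_rule_rhs n f = (\<Sum>q\<in>{1..n}. ratfun_pderiv (Unk q 0) f * rvar (Unk q 1))"

definition transformed_system ::
    "nat \<Rightarrow> nat \<Rightarrow> (nat \<Rightarrow> nat) \<Rightarrow> nat \<Rightarrow> ('k::field \<Rightarrow> dexpr) \<Rightarrow> (nat \<Rightarrow> dvar ratfun) \<Rightarrow>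
     (nat \<Rightarrow> 'k poly) \<Rightarrow> deqn set" where
  "transformed_system n l \<nu> N \<sigma> r F =
     {(transformed_eqn \<sigma> (F k), 0) | k. k \<in> {1..N}} \<union>
     {(to_ac (r (zpos \<nu> i (j + 1))), to_ac (chain_rule_rhs n (r (zpos \<nu> i j)))) | i j.
        i \<in> {1..l} \<and> j < \<nu> i}"

end

theory Submission
  imports Defs
begin

text \<open>
  A coefficient that is rational in \<open>z\<close> stays rational after the substitution, and the equations
  coming from the chain rule are always algebraic, so only the equations \<open>G\<^sub>k\<close> matter, and they
  are algebraic as soon as all \<open>\<sigma> h\<close> are rational. Conversely let \<open>G = \<Sum> c\<^sub>i x\<^sup>i\<close> be a rational function,
  where the \<open>c\<^sub>i\<close> are algebraic over \<open>\<complex>(w)\<close>. Partial derivatives annihilate whatever is algebraic over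
  rational functions free of the variable in question; hence \<open>\<complex>(w, x)\<close> is algebraically closed among
  all rational functions and contains \<open>G\<close>, and \<open>x\<close> is transcendental over the \<open>c\<^sub>i\<close>. Therefore
  \<open>G = P/Q\<close> with \<open>P, Q\<close> polynomials over \<open>\<complex>(w)\<close>, and \<open>Q G = P\<close> is an exact division of
  polynomials in \<open>x\<close>, so that its quotient has coefficients in \<open>\<complex>(w)\<close>.
\<close>

section \<open>Subfields and algebraic elements\<close>

text \<open>The whole type as an explicit ring record, which makes the field extension theory of
  HOL-Algebra available to class-based fields. The simp rules that follow translate its operations
  back.\<close>

abbreviation (input) univ_ring :: "'a::ring_1 ring" where
  "univ_ring \<equiv> ring_of_type_algebra"

lemma univ_ring_simps [simp]:
  "carrier univ_ring = UNIV" "x \<otimes>\<^bsub>univ_ring\<^esub> y = x * y" "x \<oplus>\<^bsub>univ_ring\<^esub> y = x + y"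
  "\<one>\<^bsub>univ_ring\<^esub> = 1" "\<zero>\<^bsub>univ_ring\<^esub> = 0"
  by (simp_all add: ring_of_type_algebra_def)

lemma univ_ring_uminus [simp]: "\<ominus>\<^bsub>univ_ring\<^esub> x = - (x :: 'a::comm_ring_1)"
proof -
  interpret ring "univ_ring :: 'a ring" by rule
  show ?thesis
    using minus_equality[of "- x" x] by simp
qed

lemma univ_ring_pow [simp]: "x [^]\<^bsub>univ_ring\<^esub> (k::nat) = (x :: 'a::comm_ring_1) ^ k"
proof -
  interpret ring "univ_ring :: 'a ring" by rule
  show ?thesis
    by (induction k) (simp_all add: mult.commute)
qed

lemma univ_ring_inv [simp]:
  assumes "x \<noteq> (0 :: 'a::field)"
  shows "inv\<^bsub>univ_ring\<^esub> x = inverse x"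
proof -
  interpret Ring.field "univ_ring :: 'a ring" by rule
  show ?thesis
    using comm_inv_char[of x "inverse x"] assms by simp
qed

lemma subfield_univ_ringI:
  fixes K :: "'a::field set"
  assumes "1 \<in> K" "\<And>x y. x \<in> K \<Longrightarrow> y \<in> K \<Longrightarrow> x + y \<in> K" "\<And>x. x \<in> K \<Longrightarrow> - x \<in> K"
    "\<And>x y. x \<in> K \<Longrightarrow> y \<in> K \<Longrightarrow> x * y \<in> K" "\<And>x. x \<in> K \<Longrightarrow> x \<noteq> 0 \<Longrightarrow> inverse x \<in> K"
  shows "subfield K univ_ring"
proof -
  interpret Ring.field "univ_ring :: 'a ring" by rule
  show ?thesis
    by (rule subfieldI'[OF subringI]) (use assms in auto)
qed

text \<open>Collects closure properties in class-based notation. The record-based interpretation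
  made inside is local to this context.\<close>

locale subfield_type =
  fixes K :: "'a::field set"
  assumes subfield: "subfield K univ_ring"
begin

interpretation univ: Ring.field "univ_ring :: 'a ring" by rule

lemma zero_mem: "0 \<in> K" and one_mem: "1 \<in> K"
  using subringE(2,3)[OF subfieldE(1)[OF subfield]] by simp_all

lemma uminus_mem: "x \<in> K \<Longrightarrow> - x \<in> K"
  using subringE(5)[OF subfieldE(1)[OF subfield]] by simp

lemma mult_mem: "x \<in> K \<Longrightarrow> y \<in> K \<Longrightarrow> x * y \<in> K"
  and add_mem: "x \<in> K \<Longrightarrow> y \<in> K \<Longrightarrow> x + y \<in> K"
  using subringE(6,7)[OF subfieldE(1)[OF subfield]] by simp_all

lemma diff_mem: "x \<in> K \<Longrightarrow> y \<in> K \<Longrightarrow> x - y \<in> K"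
  using add_mem[of x "- y"] uminus_mem[of y] by simp

lemma inverse_mem: "x \<in> K \<Longrightarrow> inverse x \<in> K"
  using univ.subfield_m_inv(1)[OF subfield, of x] by (cases "x = 0") (auto simp: zero_mem)

lemma divide_mem: "x \<in> K \<Longrightarrow> y \<in> K \<Longrightarrow> x / y \<in> K"
  by (simp add: divide_inverse mult_mem inverse_mem)

lemma power_mem: "x \<in> K \<Longrightarrow> x ^ k \<in> K"
  by (induction k) (auto simp: one_mem mult_mem)

lemma of_nat_mem: "of_nat k \<in> K"
  by (induction k) (auto simp: one_mem add_mem zero_mem)

lemma sum_mem: "(\<And>i. i \<in> A \<Longrightarrow> f i \<in> K) \<Longrightarrow> sum f A \<in> K"
  by (induction A rule: infinite_finite_induct) (auto simp: add_mem zero_mem)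

lemma poly_mem:
  assumes "\<And>i. Polynomial.coeff p i \<in> K" "x \<in> K"
  shows "Polynomial.poly p x \<in> K"
  unfolding poly_altdef by (intro sum_mem mult_mem power_mem assms)

lemma coeff_mult_mem:
  assumes "\<And>i. Polynomial.coeff p i \<in> K" "\<And>i. Polynomial.coeff q i \<in> K"
  shows "Polynomial.coeff (p * q) i \<in> K"
  unfolding coeff_mult by (intro sum_mem mult_mem assms)

text \<open>HOL-Algebra lists coefficients from the leading one down, \<open>Poly\<close> from the
  constant one up; hence the reversal.\<close>

lemma eval_univ_ring: "univ.eval p x = Polynomial.poly (Poly (rev p)) x"
  by (induction p) (auto simp: Poly_append poly_monom)

lemma algebraic_over_iff: "x \<in> algebraic_over K \<longleftrightarrow> (univ.algebraic over K) x"
proof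
  assume "x \<in> algebraic_over K"
  then obtain p where p: "p \<noteq> 0" "\<And>i. Polynomial.coeff p i \<in> K" "Polynomial.poly p x = 0"
    by (auto simp: algebraic_over_def)
  have "set (rev (coeffs p)) \<subseteq> K" "hd (rev (coeffs p)) \<noteq> 0"
    using p by (auto simp: coeffs_def hd_rev last_coeffs_eq_coeff_degree)
  then have "rev (coeffs p) \<in> carrier (K[X]\<^bsub>univ_ring\<^esub>)"
    by (simp add: univ_poly_def polynomial_def)
  then show "(univ.algebraic over K) x"
    by (rule univ.algebraicI) (use p in \<open>auto simp: eval_univ_ring\<close>)
next
  assume "(univ.algebraic over K) x"
  then obtain p where p: "p \<in> carrier (K[X]\<^bsub>univ_ring\<^esub>)" "p \<noteq> []" "univ.eval p x = 0"
    using univ.algebraicE[OF subfieldE(1)[OF subfield], of x] by auto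
  then have sub: "set p \<subseteq> K" "hd p \<noteq> 0"
    by (auto simp: univ_poly_def polynomial_def)
  show "x \<in> algebraic_over K"
    unfolding algebraic_over_def
  proof (intro CollectI exI conjI allI)
    show "Poly (rev p) \<noteq> 0"
    proof
      assume "Poly (rev p) = 0"
      then obtain k where "rev p = replicate k 0"
        by (auto simp: Poly_eq_0)
      then have "hd p \<in> {0}"
        using p(2) by (metis hd_in_set in_set_replicate set_rev singletonI)
      then show False
        using sub by simp
    qed
    show "Polynomial.coeff (Poly (rev p)) i \<in> K" for i
      using sub zero_mem by (auto simp: coeff_Poly_eq nth_default_def subset_iff)
         (metis length_rev nth_mem set_rev)
    show "Polynomial.poly (Poly (rev p)) x = 0"
      using p by (simp add: eval_univ_ring)
  qed
qed

lemma algebraic_over_superset: "K \<subseteq> algebraic_over K"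
  using univ.algebraic_self[OF subfieldE(1)[OF subfield]] by (auto simp: algebraic_over_iff)

lemma subfield_algebraic_over: "subfield (algebraic_over K) univ_ring"
  using univ.subfield_of_algebraics[OF subfield]
  by (simp flip: algebraic_over_iff)

text \<open>A root is algebraic already over the finite extension generated by the finitely many
  coefficients, so degrees multiply.\<close>

lemma algebraic_over_idem: "algebraic_over (algebraic_over K) \<subseteq> algebraic_over K"
proof
  fix x assume "x \<in> algebraic_over (algebraic_over K)"
  then have "(univ.algebraic over algebraic_over K) x"
    using subfield_type.algebraic_over_iff[of "algebraic_over K"]
    by (simp add: subfield_type_def subfield_algebraic_over)
  then obtain p where p: "p \<in> carrier ((algebraic_over K)[X]\<^bsub>univ_ring\<^esub>)" "p \<noteq> []"
      "univ.eval p x = 0"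
    using univ.algebraicE[OF subfieldE(1)[OF subfield_algebraic_over], of x] by auto
  define E where "E = univ.finite_extension K p"
  have alg: "\<And>y. y \<in> set p \<Longrightarrow> (univ.algebraic over K) y"
    using p by (auto simp: univ_poly_def polynomial_def simp flip: algebraic_over_iff)
  have E: "subfield E univ_ring" "univ.finite_dimension K E"
    using univ.finite_extension_is_subfield[OF subfield _ alg]
      univ.finite_extension_finite_dimension(1)[OF subfield _ alg] by (simp_all add: E_def)
  have "set p \<subseteq> E"
    using univ.finite_extension_mem[OF subfieldE(1)[OF subfield], of p] by (simp add: E_def)
  then have "p \<in> carrier (E[X]\<^bsub>univ_ring\<^esub>)"
    using p by (auto simp: univ_poly_def polynomial_def)
  then have "(univ.algebraic over E) x"
    using p by (intro univ.algebraicI) auto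
  then have "univ.finite_dimension E (univ.simple_extension E x)"
    using univ.finite_dimension_simple_extension[OF E(1), of x] by simp
  then have "univ.finite_dimension K (univ.finite_extension K (x # p))"
    using univ.telescopic_base_dim(1)[OF subfield E] by (simp add: E_def)
  then show "x \<in> algebraic_over K"
    using univ.finite_extension_finite_dimension(2)[OF subfield, of "x # p" x]
    by (simp add: algebraic_over_iff)
qed

text \<open>Long division: the leading coefficient of \<open>g\<close> is a quotient of leading
  coefficients of \<open>p\<close> and \<open>q\<close>, so it lies in \<open>K\<close>. Removing
  the leading term of \<open>g\<close> leaves an exact division with a quotient of smaller
  degree.\<close>

lemma coeff_quotient_mem:
  fixes p q g :: "'a poly"
  assumes "q \<noteq> 0" "\<And>i. Polynomial.coeff q i \<in> K" "\<And>i. Polynomial.coeff p i \<in> K" "q * g = p"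
  shows "Polynomial.coeff g i \<in> K"
  using assms(3,4)
proof (induction "Polynomial.degree g" arbitrary: g p i rule: less_induct)
  case less
  define c where "c = Polynomial.lead_coeff g"
  define h where "h = g - Polynomial.monom c (Polynomial.degree g)"
  have "Polynomial.lead_coeff q * c = Polynomial.lead_coeff p"
    using less.prems(2) by (auto simp: c_def lead_coeff_mult)
  then have "c = Polynomial.lead_coeff p / Polynomial.lead_coeff q"
    using assms(1) by (auto simp: field_simps)
  then have c: "c \<in> K"
    using assms(2) less.prems(1) by (simp add: divide_mem)
  have mon: "Polynomial.coeff (Polynomial.monom c (Polynomial.degree g)) j \<in> K" for j
    using c zero_mem by simp
  have "Polynomial.coeff h i \<in> K"
  \<comment> \<open>For constant \<open>g\<close> the degree cannot drop, but then nothing remains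
    after subtracting the leading term.\<close>
  proof (cases "Polynomial.degree g = 0")
    case True
    then have "h = 0"
      by (metis c_def h_def degree_0_id monom_0 right_minus_eq)
    then show ?thesis
      by (simp add: zero_mem)
  next
    case False
    have "Polynomial.degree h \<le> Polynomial.degree g"
      unfolding h_def by (intro degree_diff_le degree_monom_le order.refl)
    moreover have "Polynomial.coeff h (Polynomial.degree g) = 0"
      by (simp add: h_def c_def)
    ultimately have "Polynomial.degree h < Polynomial.degree g"
      using False by (metis eq_zero_or_degree_less degree_0 neq0_conv)
    moreover have "q * h = p - q * Polynomial.monom c (Polynomial.degree g)"
      by (simp add: h_def less.prems(2) right_diff_distrib)
    moreover have "Polynomial.coeff (p - q * Polynomial.monom c (Polynomial.degree g)) j \<in> K" for j
      using coeff_mult_mem[OF assms(2) mon] less.prems(1) by (simp add: diff_mem)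
    ultimately show ?thesis
      using less.hyps by blast
  qed
  then have "Polynomial.coeff h i + Polynomial.coeff (Polynomial.monom c (Polynomial.degree g)) i \<in> K"
    by (intro add_mem mon)
  then show ?case
    by (simp add: h_def)
qed

end

lemma algebraic_over_mono: "K \<subseteq> K' \<Longrightarrow> algebraic_over K \<subseteq> algebraic_over K'"
  unfolding algebraic_over_def by blast


section \<open>Partial derivatives of rational functions\<close>

text \<open>Characteristic zero keeps the derivative of a nonconstant polynomial nonzero, on which
  the descent in \<open>ratfun_pderiv_eq_0_if_root\<close> relies.\<close>

instance fract :: ("{idom,ring_char_0}") field_char_0
proof
  show "inj (of_nat :: nat \<Rightarrow> 'a fract)"
    by (rule injI) (simp add: of_nat_fract eq_fract)
qed

section \<open>Variables and partial derivatives of polynomials\<close>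

lemma mpol_vars_const [simp]: "mpol_vars (Poly_Mapping.single 0 c) = {}"
  by (simp add: mpol_vars_def)

lemma mpol_vars_1 [simp]: "mpol_vars 1 = {}"
  by (simp flip: single_one)

lemma mpol_vars_uminus [simp]: "mpol_vars (- p) = mpol_vars p"
  by (simp add: mpol_vars_def)

lemma mpol_vars_add: "mpol_vars (p + q) \<subseteq> mpol_vars p \<union> mpol_vars q"
  using Poly_Mapping.keys_add[of p q] by (force simp: mpol_vars_def)

lemma mpol_vars_mult: "mpol_vars (p * q) \<subseteq> mpol_vars p \<union> mpol_vars q"
proof
  fix v assume "v \<in> mpol_vars (p * q)"
  then obtain m where "m \<in> Poly_Mapping.keys (p * q)" "v \<in> Poly_Mapping.keys m"
    by (auto simp: mpol_vars_def)
  then obtain a b where "a \<in> Poly_Mapping.keys p" "b \<in> Poly_Mapping.keys q"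
      "v \<in> Poly_Mapping.keys (a + b)"
    using Poly_Mapping.keys_mult[of p q] by auto
  then show "v \<in> mpol_vars p \<union> mpol_vars q"
    using Poly_Mapping.keys_add[of a b] by (auto simp: mpol_vars_def)
qed

lemma mpol_vars_var [simp]:
  "mpol_vars (Poly_Mapping.single (Poly_Mapping.single v (1::nat)) 1) = {v}"
  by (simp add: mpol_vars_def)

lemma lookup_mpol_pderiv:
  "Poly_Mapping.lookup (mpol_pderiv v p) k =
     of_nat (Suc (Poly_Mapping.lookup k v)) * Poly_Mapping.lookup p (k + Poly_Mapping.single v 1)"
proof -
  let ?s = "Poly_Mapping.single v (1::nat)"
  \<comment> \<open>Truncated subtraction can be undone when \<open>v\<close> occurs in
    \<open>m\<close>; all other monomials carry the factor zero.\<close>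
  have eq: "m = k + ?s" if "m - ?s = k" "Poly_Mapping.lookup m v \<noteq> 0" for m :: "'a \<Rightarrow>\<^sub>0 nat"
    unfolding that(1)[symmetric]
    by (rule poly_mapping_eqI) (use that(2) in \<open>auto simp: lookup_add lookup_minus lookup_single when_def\<close>)
  \<comment> \<open>\<open>k + ?s\<close> is inserted because it need not be a monomial of
    \<open>p\<close>; its summand is zero in that case.\<close>
  have "Poly_Mapping.lookup (mpol_pderiv v p) k =
      (\<Sum>m\<in>insert (k + ?s) (Poly_Mapping.keys p). Poly_Mapping.lookup (Poly_Mapping.single (m - ?s)
         (of_nat (Poly_Mapping.lookup m v) * Poly_Mapping.lookup p m)) k)"
    by (subst mpol_pderiv_superset[where A = "insert (k + ?s) (Poly_Mapping.keys p)"])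
      (auto simp: lookup_sum)
  also have "\<dots> = (\<Sum>m\<in>{k + ?s}. Poly_Mapping.lookup (Poly_Mapping.single (m - ?s)
         (of_nat (Poly_Mapping.lookup m v) * Poly_Mapping.lookup p m)) k)"
    by (rule sum.mono_neutral_right) (use eq in \<open>auto simp: lookup_single when_def\<close>)
  finally show ?thesis
    by (simp add: lookup_add)
qed

text \<open>The factor \<open>Suc\<close> in \<open>lookup_mpol_pderiv\<close> is nonzero in
  characteristic zero, and different monomials containing \<open>v\<close> have different
  derivatives, so nothing cancels.\<close>

lemma mpol_pderiv_eq_0_iff: "mpol_pderiv v p = 0 \<longleftrightarrow> v \<notin> mpol_vars p"
proof
  assume *: "mpol_pderiv v p = 0"
  show "v \<notin> mpol_vars p"
  proof
    assume "v \<in> mpol_vars p"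
    then obtain m where m: "Poly_Mapping.lookup p m \<noteq> 0" "Poly_Mapping.lookup m v \<noteq> 0"
      by (auto simp: mpol_vars_def in_keys_iff)
    have "m - Poly_Mapping.single v 1 + Poly_Mapping.single v 1 = m"
      by (rule poly_mapping_eqI)
        (use m(2) in \<open>auto simp: lookup_add lookup_minus lookup_single when_def\<close>)
    then have "of_nat (Suc (Poly_Mapping.lookup (m - Poly_Mapping.single v 1) v)) *
        Poly_Mapping.lookup p m = 0"
      using lookup_mpol_pderiv[of v p "m - Poly_Mapping.single v 1"] * by simp
    then show False
      using m(1) by (metis mult_eq_0_iff of_nat_eq_0_iff nat.distinct(1))
  qed
next
  assume "v \<notin> mpol_vars p"
  moreover have "v \<in> Poly_Mapping.keys (k + Poly_Mapping.single v 1)" for k :: "'a \<Rightarrow>\<^sub>0 nat"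
    by (simp add: in_keys_iff lookup_add)
  ultimately have "k + Poly_Mapping.single v 1 \<notin> Poly_Mapping.keys p" for k
    unfolding mpol_vars_def by blast
  then show "mpol_pderiv v p = 0"
    by (intro poly_mapping_eqI) (simp add: lookup_mpol_pderiv in_keys_iff)
qed

lemma mpol_vars_pderiv: "mpol_vars (mpol_pderiv v p) \<subseteq> mpol_vars p"
proof
  fix u assume "u \<in> mpol_vars (mpol_pderiv v p)"
  then obtain m where m: "m \<in> Poly_Mapping.keys (mpol_pderiv v p)" "u \<in> Poly_Mapping.keys m"
    by (auto simp: mpol_vars_def)
  then have "m + Poly_Mapping.single v 1 \<in> Poly_Mapping.keys p"
    by (auto simp: in_keys_iff lookup_mpol_pderiv)
  moreover have "u \<in> Poly_Mapping.keys (m + Poly_Mapping.single v 1)"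
    using m(2) by (simp add: in_keys_iff lookup_add)
  ultimately show "u \<in> mpol_vars p"
    unfolding mpol_vars_def by blast
qed

text \<open>Constants and the variables in \<open>V\<close> generate the polynomials over
  \<open>V\<close> as a ring. The proof passes through powers of a variable, monomials and partial
  sums of \<open>p\<close>.\<close>

lemma mpol_induct [consumes 1, case_names const var add mult]:
  assumes "mpol_vars p \<subseteq> V"
    and const: "\<And>c. P (Poly_Mapping.single 0 c)"
    and var: "\<And>v. v \<in> V \<Longrightarrow> P (Poly_Mapping.single (Poly_Mapping.single v 1) 1)"
    and add: "\<And>p q. P p \<Longrightarrow> P q \<Longrightarrow> P (p + q)"
    and mult: "\<And>p q. P p \<Longrightarrow> P q \<Longrightarrow> P (p * q)"
  shows "P (p :: 'v mpol)"
proof -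
  have power: "P (Poly_Mapping.single (Poly_Mapping.single v k) 1)" if "v \<in> V" for v k
  proof (induction k)
    case 0
    then show ?case
      using const[of 1] by simp
  next
    case (Suc k)
    then show ?case
      using mult[OF var[OF that] Suc] by (simp add: mult_single flip: single_add)
  qed
  have "P (Poly_Mapping.single (\<Sum>v\<in>A. Poly_Mapping.single v (Poly_Mapping.lookup m v)) c)"
    if "finite A" "A \<subseteq> V" for A m c
    using that
  proof (induction A rule: finite_induct)
    case empty
    then show ?case
      using const[of c] by simp
  next
    case (insert v A)
    then show ?case
      using mult[OF power[of v "Poly_Mapping.lookup m v"]] by (fastforce simp: mult_single)
  qed
  moreover have "(\<Sum>v\<in>Poly_Mapping.keys m. Poly_Mapping.single v (Poly_Mapping.lookup m v)) = m"
    for m :: "'v \<Rightarrow>\<^sub>0 nat"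
    by (rule poly_mapping_eqI)
      (auto simp: lookup_sum lookup_single when_def in_keys_iff sum.delta[OF finite_keys])
  ultimately have monom: "P (Poly_Mapping.single m c)" if "Poly_Mapping.keys m \<subseteq> V" for m c
    using that by (metis finite_keys)
  have "P (\<Sum>m\<in>A. Poly_Mapping.single m (Poly_Mapping.lookup p m))"
    if "A \<subseteq> Poly_Mapping.keys p" for A
    using finite_subset[OF that finite_keys] that
  proof (induction A rule: finite_induct)
    case empty
    then show ?case
      using const[of 0] by simp
  next
    case (insert m A)
    then have "Poly_Mapping.keys m \<subseteq> V"
      using assms(1) by (auto simp: mpol_vars_def)
    then show ?case
      using insert by (simp add: add monom)
  qed
  from this[OF order.refl] show ?thesis
    by (simp flip: mpol_as_sum)
qed

section \<open>Fields of rational functions in prescribed variables\<close>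

lemma ratfunsI:
  "q \<noteq> 0 \<Longrightarrow> mpol_vars p \<subseteq> V \<Longrightarrow> mpol_vars q \<subseteq> V \<Longrightarrow> Fract p q \<in> ratfuns V"
  by (auto simp: ratfuns_def)

lemma ratfunsE:
  assumes "f \<in> ratfuns V"
  obtains p q where "f = Fract p q" "q \<noteq> 0" "mpol_vars p \<subseteq> V" "mpol_vars q \<subseteq> V"
  using assms by (auto simp: ratfuns_def)

lemma ratfuns_mono: "V \<subseteq> W \<Longrightarrow> ratfuns V \<subseteq> ratfuns W"
  by (force simp: ratfuns_def)

lemma rconst_mem_ratfuns: "rconst c \<in> ratfuns V"
  by (simp add: rconst_def ratfunsI)

lemma rvar_mem_ratfuns: "v \<in> V \<Longrightarrow> rvar v \<in> ratfuns V"
  unfolding rvar_def by (rule ratfunsI) (simp_all flip: One_nat_def)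

lemma subfield_ratfuns: "subfield (ratfuns V) univ_ring"
proof (rule subfield_univ_ringI)
  show "1 \<in> ratfuns V"
    by (simp add: One_fract_def ratfunsI)
  fix x assume "x \<in> ratfuns V"
  then obtain p q where x: "x = Fract p q" "q \<noteq> 0" "mpol_vars p \<subseteq> V" "mpol_vars q \<subseteq> V"
    by (rule ratfunsE)
  show "- x \<in> ratfuns V"
    using x by (simp add: ratfunsI)
  show "inverse x \<in> ratfuns V" if "x \<noteq> 0"
    using x that by (auto simp: ratfunsI eq_fract Zero_fract_def)
  fix y assume "y \<in> ratfuns V"
  then obtain p' q' where y: "y = Fract p' q'" "q' \<noteq> 0" "mpol_vars p' \<subseteq> V" "mpol_vars q' \<subseteq> V"
    by (rule ratfunsE)
  note vars = order.trans[OF mpol_vars_add Un_least] order.trans[OF mpol_vars_mult Un_least]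
  show "x + y \<in> ratfuns V"
    using x y by (simp add: ratfunsI vars)
  show "x * y \<in> ratfuns V"
    using x y by (simp add: ratfunsI vars)
qed

interpretation ratfuns: subfield_type "ratfuns V" for V :: "'v::linorder set"
  by (rule subfield_type.intro) (rule subfield_ratfuns)

interpretation ratfuns_ac: subfield_type "to_ac ` ratfuns V" for V :: "'v::linorder set"
proof (rule subfield_type.intro)
  show "subfield (to_ac ` ratfuns V) univ_ring"
  proof (rule subfield_univ_ringI)
    show "1 \<in> to_ac ` ratfuns V"
      using ratfuns.one_mem by (metis image_eqI to_ac_1)
    fix x assume "x \<in> to_ac ` ratfuns V"
    then obtain f where f: "x = to_ac f" "f \<in> ratfuns V"
      by blast
    show "- x \<in> to_ac ` ratfuns V"
      using f ratfuns.uminus_mem by (metis image_eqI to_ac_minus)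
    show "inverse x \<in> to_ac ` ratfuns V"
      using f ratfuns.inverse_mem by (metis image_eqI to_ac_inverse)
    fix y assume "y \<in> to_ac ` ratfuns V"
    then obtain g where g: "y = to_ac g" "g \<in> ratfuns V"
      by blast
    show "x + y \<in> to_ac ` ratfuns V"
      using f g ratfuns.add_mem by (metis image_eqI to_ac_add)
    show "x * y \<in> to_ac ` ratfuns V"
      using f g ratfuns.mult_mem by (metis image_eqI to_ac_mult)
  qed
qed

section \<open>Derivations and relative algebraic closedness\<close>

lemma ratfun_pderiv_mem_ratfuns:
  assumes "f \<in> ratfuns V"
  shows "ratfun_pderiv v f \<in> ratfuns V"
proof -
  obtain p q where f: "f = Fract p q" "q \<noteq> 0" "mpol_vars p \<subseteq> V" "mpol_vars q \<subseteq> V"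
    using assms by (rule ratfunsE)
  \<comment> \<open>The quotient rule is spelled out with field operations on fractions of
    denominator 1, so that closure of the subfield applies.\<close>
  have "Fract (mpol_pderiv v p * q - p * mpol_pderiv v q) (q * q) =
      (Fract (mpol_pderiv v p) 1 * Fract q 1 - Fract p 1 * Fract (mpol_pderiv v q) 1) /
      (Fract q 1 * Fract q 1)"
    using f(2) by simp
  also have "\<dots> \<in> ratfuns V"
    using f mpol_vars_pderiv[of v p] mpol_vars_pderiv[of v q]
    by (intro ratfuns.divide_mem ratfuns.diff_mem ratfuns.mult_mem ratfunsI) auto
  finally show ?thesis
    using f by (simp add: ratfun_pderiv_Fract)
qed

lemma ratfun_pderiv_outside:
  assumes "f \<in> ratfuns V" "v \<notin> V"
  shows "ratfun_pderiv v f = 0"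
proof -
  obtain p q where f: "f = Fract p q" "q \<noteq> 0" "mpol_vars p \<subseteq> V" "mpol_vars q \<subseteq> V"
    using assms(1) by (rule ratfunsE)
  then have "mpol_pderiv v p = 0" "mpol_pderiv v q = 0"
    using assms(2) by (auto simp: mpol_pderiv_eq_0_iff)
  then show ?thesis
    using f by (simp add: ratfun_pderiv_Fract Zero_fract_def eq_fract)
qed

lemma ratfun_pderiv_add: "ratfun_pderiv v (f + g) = ratfun_pderiv v f + ratfun_pderiv v g"
proof -
  obtain p q where f: "f = Fract p q" "q \<noteq> 0" by (cases f)
  obtain p' q' where g: "g = Fract p' q'" "q' \<noteq> 0" by (cases g)
  show ?thesis
    using f(2) g(2)
    by (simp add: f(1) g(1) ratfun_pderiv_Fract eq_fract mpol_pderiv_add mpol_pderiv_mult algebra_simps)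
qed

lemma ratfun_pderiv_mult:
  "ratfun_pderiv v (f * g) = ratfun_pderiv v f * g + f * ratfun_pderiv v g"
proof -
  obtain p q where f: "f = Fract p q" "q \<noteq> 0" by (cases f)
  obtain p' q' where g: "g = Fract p' q'" "q' \<noteq> 0" by (cases g)
  show ?thesis
    using f(2) g(2)
    by (simp add: f(1) g(1) ratfun_pderiv_Fract eq_fract mpol_pderiv_mult algebra_simps)
qed

lemma ratfun_pderiv_rvar: "ratfun_pderiv v (rvar v) = 1"
proof -
  let ?x = "Poly_Mapping.single (Poly_Mapping.single v (1::nat)) (1::complex)"
  have "mpol_pderiv v 1 = 0" "mpol_pderiv v ?x = 1"
    by (simp_all add: mpol_pderiv_eq_0_iff mpol_pderiv_single del: single_one flip: One_nat_def)
       simp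
  then show ?thesis
    by (simp add: rvar_def ratfun_pderiv_Fract One_fract_def flip: One_nat_def)
qed

text \<open>If \<open>\<partial>(p/q) = 0\<close> then \<open>p/q = \<partial>p/\<partial>q\<close> unless \<open>\<partial>q = 0\<close>, so a denominator of minimal degree
  involves no variable along which the fraction is constant.\<close>

lemma ratfunsI_pderiv:
  assumes "\<And>v. v \<notin> V \<Longrightarrow> ratfun_pderiv v f = 0"
  shows "f \<in> ratfuns V"
proof -
  define deg :: "('a \<Rightarrow>\<^sub>0 nat) \<Rightarrow> nat" where
    "deg m = (\<Sum>v\<in>Poly_Mapping.keys m. Poly_Mapping.lookup m v)" for m
  have deg: "deg (m + Poly_Mapping.single v 1) = Suc (deg m)" for m v
  proof -
    \<comment> \<open>The total degree is summed over a set containing \<open>v\<close>, since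
      \<open>v\<close> may be absent from \<open>m\<close>.\<close>
    let ?A = "insert v (Poly_Mapping.keys m)"
    have super: "deg k = (\<Sum>u\<in>?A. Poly_Mapping.lookup k u)" if "Poly_Mapping.keys k \<subseteq> ?A" for k
      unfolding deg_def by (rule sum.mono_neutral_left) (use that in \<open>auto simp: in_keys_iff\<close>)
    have "Poly_Mapping.keys (m + Poly_Mapping.single v 1) \<subseteq> ?A"
      using Poly_Mapping.keys_add[of m "Poly_Mapping.single v 1"] by auto
    then have "deg (m + Poly_Mapping.single v 1) =
        (\<Sum>u\<in>?A. Poly_Mapping.lookup m u) + (\<Sum>u\<in>?A. if v = u then 1 else 0)"
      by (subst super) (auto simp: lookup_add lookup_single when_def sum.distrib)
    also have "\<dots> = Suc (deg m)"
      using super[OF subset_insertI] by (subst sum.delta') auto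
    finally show ?thesis .
  qed
  \<comment> \<open>The bound \<open>d\<close> on the total degrees in the denominator is strict, so
    \<open>d = 0\<close> would force \<open>q = 0\<close>.\<close>
  have "Fract p q \<in> ratfuns V" if "q \<noteq> 0" "f = Fract p q" "\<And>m. m \<in> Poly_Mapping.keys q \<Longrightarrow> deg m < d"
    for p q d
    using that
  proof (induction d arbitrary: p q)
    case 0
    then have "m \<notin> Poly_Mapping.keys q" for m
      by blast
    then have "Poly_Mapping.keys q = {}"
      by blast
    with 0(1) show ?case
      by simp
  next
    case (Suc d)
    have "Fract (mpol_pderiv v p * q - p * mpol_pderiv v q) (q * q) = 0" if "v \<notin> V" for v
      using assms[OF that] Suc.prems by (simp add: ratfun_pderiv_Fract)
    then have eq: "mpol_pderiv v p * q = p * mpol_pderiv v q" if "v \<notin> V" for v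
      using Suc.prems(1) that by (simp add: Zero_fract_def eq_fract)
    show ?case
    proof (cases "\<exists>v. v \<notin> V \<and> mpol_pderiv v q \<noteq> 0")
      case True
      then obtain v where v: "v \<notin> V" "mpol_pderiv v q \<noteq> 0"
        by blast
      have "Fract p q = Fract (mpol_pderiv v p) (mpol_pderiv v q)"
        using eq[OF v(1)] v(2) Suc.prems(1) by (simp add: eq_fract)
      moreover have "deg m < d" if "m \<in> Poly_Mapping.keys (mpol_pderiv v q)" for m
      proof -
        have "m + Poly_Mapping.single v 1 \<in> Poly_Mapping.keys q"
          using that by (auto simp: in_keys_iff lookup_mpol_pderiv)
        then show ?thesis
          using Suc.prems(3) by (fastforce simp: deg simp del: One_nat_def)
      qed
      ultimately show ?thesis
        using Suc.IH[OF v(2)] Suc.prems(2) by metis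
    next
      case False
      \<comment> \<open>Once the derivative of \<open>q\<close> vanishes, \<open>eq\<close> gives
        \<open>mpol_pderiv v p * q = 0\<close>, and \<open>q\<close> is nonzero.\<close>
      then have "mpol_pderiv v q = 0" "mpol_pderiv v p = 0" if "v \<notin> V" for v
        using eq[OF that] that Suc.prems(1) by auto
      then show ?thesis
        using Suc.prems(1) by (intro ratfunsI) (auto simp: mpol_pderiv_eq_0_iff)
    qed
  qed
  moreover obtain p q where "f = Fract p q" "q \<noteq> 0"
    by (cases f)
  moreover have "\<exists>d. \<forall>m\<in>Poly_Mapping.keys q. deg m < d"
    using finite_keys finite_nat_set_iff_bounded[of "deg ` Poly_Mapping.keys q"] by blast
  ultimately show ?thesis
    by metis
qed

text \<open>The chain rule for a polynomial whose coefficients are constants of the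
  derivation.\<close>

lemma ratfun_pderiv_poly:
  assumes "\<And>i. ratfun_pderiv v (Polynomial.coeff p i) = 0"
  shows "ratfun_pderiv v (Polynomial.poly p f) = Polynomial.poly (pderiv p) f * ratfun_pderiv v f"
  using assms
proof (induction p)
  case 0
  then show ?case
    by (metis coeff_0 mult_zero_left pderiv_0 poly_0)
next
  case (pCons a p)
  have "ratfun_pderiv v a = 0" "\<And>i. ratfun_pderiv v (Polynomial.coeff p i) = 0"
    using pCons.prems[of 0] pCons.prems[of "Suc _"] by simp_all
  then show ?case
    using pCons.IH by (simp add: ratfun_pderiv_add ratfun_pderiv_mult pderiv_pCons algebra_simps)
qed

text \<open>Differentiating \<open>p(f) = 0\<close> along \<open>v\<close> gives
  \<open>p'(f) * \<partial>f = 0\<close>. Either \<open>\<partial>f = 0\<close>, or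
  \<open>p'\<close> is a nonzero polynomial of smaller degree over the same field that also
  annihilates \<open>f\<close>.\<close>

lemma ratfun_pderiv_eq_0_if_root:
  fixes p :: "'v::linorder ratfun poly"
  assumes "p \<noteq> 0" "\<And>i. Polynomial.coeff p i \<in> ratfuns V" "Polynomial.poly p f = 0" "v \<notin> V"
  shows "ratfun_pderiv v f = 0"
  using assms(1-3)
proof (induction "Polynomial.degree p" arbitrary: p rule: less_induct)
  case less
  have "Polynomial.poly (pderiv p) f * ratfun_pderiv v f = ratfun_pderiv v 0"
    using ratfun_pderiv_poly[of v p f] less.prems assms(4) ratfun_pderiv_outside by metis
  also have "\<dots> = 0"
    using ratfun_pderiv_outside[OF ratfuns.zero_mem assms(4)] .
  finally consider "Polynomial.poly (pderiv p) f = 0" | "ratfun_pderiv v f = 0"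
    by auto
  then show ?case
  proof cases
    case 1
    have deg: "Polynomial.degree p \<noteq> 0"
    proof
      assume "Polynomial.degree p = 0"
      then obtain a where "p = [:a:]"
        by (rule degree_eq_zeroE)
      then show False
        using less.prems by simp
    qed
    then have "pderiv p \<noteq> 0" "Polynomial.degree (pderiv p) < Polynomial.degree p"
      by (simp_all add: pderiv_eq_0_iff degree_pderiv)
    moreover have "Polynomial.coeff (pderiv p) i \<in> ratfuns V" for i
      unfolding coeff_pderiv by (intro ratfuns.mult_mem ratfuns.of_nat_mem less.prems)
    ultimately show ?thesis
      using less.hyps 1 by blast
  qed
qed

text \<open>All derivatives along variables outside \<open>V\<close> vanish on an algebraic element,
  and \<open>ratfunsI_pderiv\<close> turns this into membership.\<close>

lemma mem_ratfuns_if_algebraic: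
  assumes "to_ac f \<in> algebraic_over (to_ac ` ratfuns V)"
  shows "f \<in> ratfuns V"
proof -
  obtain p where p: "p \<noteq> 0" "\<And>i. Polynomial.coeff p i \<in> to_ac ` ratfuns V"
      "Polynomial.poly p (to_ac f) = 0"
    using assms by (auto simp: algebraic_over_def)
  \<comment> \<open>\<open>of_ac\<close> inverts \<open>to_ac\<close> on its range, where all
    coefficients of \<open>p\<close> lie.\<close>
  define q where "q = map_poly of_ac p"
  have coeff_q: "Polynomial.coeff q i \<in> ratfuns V" for i
    using p(2)[of i] by (auto simp: q_def coeff_map_poly)
  have pq: "p = map_poly to_ac q"
  proof (rule Polynomial.poly_eqI)
    show "Polynomial.coeff p i = Polynomial.coeff (map_poly to_ac q) i" for i
      using p(2)[of i] by (auto simp: q_def coeff_map_poly)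
  qed
  have "to_ac (Polynomial.poly q f) = Polynomial.poly p (to_ac f)"
    unfolding pq by (induction q) (simp_all add: map_poly_pCons)
  then have "Polynomial.poly q f = 0"
    using p(3) by simp
  moreover have "q \<noteq> 0"
    using p(1) pq by auto
  ultimately show ?thesis
    by (intro ratfunsI_pderiv) (rule ratfun_pderiv_eq_0_if_root[OF _ coeff_q])
qed


section \<open>Rational values of polynomials with algebraic coefficients\<close>

lemma poly_map_poly_to_ac: "Polynomial.poly (map_poly to_ac p) (to_ac f) = to_ac (Polynomial.poly p f)"
  by (induction p) (simp_all add: map_poly_pCons)

text \<open>Reads a polynomial as univariate in \<open>v\<close> over the field generated by
  \<open>V\<close>. Induction over ring operations avoids sorting monomials by powers of
  \<open>v\<close>.\<close>

lemma mpol_as_poly: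
  assumes "mpol_vars p \<subseteq> insert v V"
  shows "\<exists>P. (\<forall>i. Polynomial.coeff P i \<in> ratfuns V) \<and> Polynomial.poly P (rvar v) = Fract p 1"
  using assms
proof (induction rule: mpol_induct)
  case (const c)
  then show ?case
    by (intro exI[of _ "[:rconst c:]"])
      (auto simp: coeff_pCons rconst_mem_ratfuns ratfuns.zero_mem rconst_def[symmetric] split: nat.split)
next
  case (var u)
  show ?case
  proof (cases "u = v")
    case True
    then show ?thesis
      by (intro exI[of _ "[:0, 1:]"])
        (auto simp: coeff_pCons ratfuns.zero_mem ratfuns.one_mem rvar_def split: nat.split)
  next
    case False
    then show ?thesis
      using var by (intro exI[of _ "[:rvar u:]"])
        (auto simp: coeff_pCons rvar_mem_ratfuns ratfuns.zero_mem rvar_def[symmetric]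
          simp del: One_nat_def split: nat.split)
  qed
next
  case (add p q)
  then obtain P Q where "\<And>i. Polynomial.coeff P i \<in> ratfuns V" "\<And>i. Polynomial.coeff Q i \<in> ratfuns V"
      "Polynomial.poly P (rvar v) = Fract p 1" "Polynomial.poly Q (rvar v) = Fract q 1"
    by blast
  then show ?case
    by (intro exI[of _ "P + Q"]) (simp add: ratfuns.add_mem)
next
  case (mult p q)
  then obtain P Q where "\<And>i. Polynomial.coeff P i \<in> ratfuns V" "\<And>i. Polynomial.coeff Q i \<in> ratfuns V"
      "Polynomial.poly P (rvar v) = Fract p 1" "Polynomial.poly Q (rvar v) = Fract q 1"
    by blast
  then show ?case
    by (intro exI[of _ "P * Q"]) (simp add: ratfuns.coeff_mult_mem)
qed

text \<open>Otherwise the variable would lie in \<open>ratfuns V\<close> and have derivative 0 along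
  itself instead of 1.\<close>

lemma rvar_not_algebraic:
  assumes "v \<notin> V"
  shows "to_ac (rvar v) \<notin> algebraic_over (to_ac ` ratfuns V)"
  using mem_ratfuns_if_algebraic[of "rvar v" V] ratfun_pderiv_outside[OF _ assms, of "rvar v"]
  by (auto simp: ratfun_pderiv_rvar)

text \<open>The value of \<open>g\<close> at \<open>v\<close> is algebraic over \<open>\<complex>(V, v)\<close>, hence equal to \<open>P(v)/Q(v)\<close> with \<open>P, Q\<close>
  polynomials over \<open>\<complex>(V)\<close>; as \<open>v\<close> is transcendental over the coefficients, \<open>Q g = P\<close> holds as an
  identity of polynomials.\<close>

lemma coeff_rational_if_value_rational:
  fixes g :: "'v::linorder ratfun alg_closure poly"
  assumes v: "v \<notin> V"
    and alg: "\<And>i. Polynomial.coeff g i \<in> algebraic_over (to_ac ` ratfuns V)"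
    and val: "Polynomial.poly g (to_ac (rvar v)) \<in> range to_ac"
  shows "Polynomial.coeff g i \<in> to_ac ` ratfuns V"
proof -
  let ?L = "\<lambda>V. to_ac ` ratfuns V :: 'v ratfun alg_closure set"
  interpret alg: subfield_type "algebraic_over (?L W)" for W
    by (rule subfield_type.intro) (rule ratfuns_ac.subfield_algebraic_over)
  obtain f where f: "Polynomial.poly g (to_ac (rvar v)) = to_ac f"
    using val by blast
  have "to_ac (rvar v) \<in> algebraic_over (?L (insert v V))"
    using ratfuns_ac.algebraic_over_superset rvar_mem_ratfuns[of v "insert v V"] by blast
  moreover have "algebraic_over (?L V) \<subseteq> algebraic_over (?L (insert v V))"
    by (intro algebraic_over_mono image_mono ratfuns_mono) auto
  ultimately have "to_ac f \<in> algebraic_over (?L (insert v V))"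
    unfolding f[symmetric] using alg by (intro alg.poly_mem) auto
  then have "f \<in> ratfuns (insert v V)"
    by (rule mem_ratfuns_if_algebraic)
  then obtain p q where pq: "f = Fract p q" "q \<noteq> 0" "mpol_vars p \<subseteq> insert v V"
      "mpol_vars q \<subseteq> insert v V"
    by (rule ratfunsE)
  obtain P where P: "\<And>i. Polynomial.coeff P i \<in> ratfuns V" "Polynomial.poly P (rvar v) = Fract p 1"
    using mpol_as_poly[OF pq(3)] by blast
  obtain Q where Q: "\<And>i. Polynomial.coeff Q i \<in> ratfuns V" "Polynomial.poly Q (rvar v) = Fract q 1"
    using mpol_as_poly[OF pq(4)] by blast
  define h where "h = map_poly to_ac Q * g - map_poly to_ac P"
  have coeffs: "Polynomial.coeff (map_poly to_ac P) i \<in> ?L V"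
      "Polynomial.coeff (map_poly to_ac Q) i \<in> ?L V" for i
    using P(1) Q(1) by (simp_all add: coeff_map_poly)
  have "Fract q 1 * f = Fract p 1"
    using pq(2) by (simp add: pq(1) eq_fract)
  then have "Polynomial.poly h (to_ac (rvar v)) = 0"
    by (simp add: h_def poly_map_poly_to_ac P Q f flip: to_ac_mult)
  moreover have "Polynomial.coeff h i \<in> algebraic_over (?L V)" for i
    unfolding h_def coeff_diff
    using coeffs ratfuns_ac.algebraic_over_superset alg
    by (intro alg.diff_mem alg.coeff_mult_mem) blast+
  \<comment> \<open>A nonzero \<open>h\<close> would make \<open>v\<close> algebraic over the
    algebraic elements, hence over \<open>ratfuns V\<close> by
    \<open>algebraic_over_idem\<close>.\<close>
  ultimately have "h = 0"
    using rvar_not_algebraic[OF v] ratfuns_ac.algebraic_over_idem[of V]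
    by (auto simp: algebraic_over_def[of "algebraic_over _"])
  then have "map_poly to_ac Q * g = map_poly to_ac P"
    by (simp add: h_def)
  \<comment> \<open>The value of \<open>Q\<close> at \<open>v\<close> is the nonzero denominator
    \<open>q\<close>.\<close>
  moreover have "map_poly to_ac Q \<noteq> 0"
  proof
    assume "map_poly to_ac Q = 0"
    then have "to_ac (Polynomial.poly Q (rvar v)) = 0"
      by (simp flip: poly_map_poly_to_ac)
    then show False
      using Q(2) pq(2) by (simp add: Zero_fract_def eq_fract)
  qed
  ultimately show ?thesis
    using ratfuns_ac.coeff_quotient_mem coeffs by metis
qed

section \<open>Homomorphisms on fields of rational functions\<close>

lemma subring_of_type_UNIV: "subring_of_type UNIV = univ_ring"
  by (simp add: subring_of_type_def ring_of_type_algebra_def)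

lemma ring_hom_subring_of_typeD:
  assumes "\<phi> \<in> Ring.ring_hom (subring_of_type A) (subring_of_type B)"
  shows "a \<in> A \<Longrightarrow> \<phi> a \<in> B" "\<phi> 1 = 1"
    "a \<in> A \<Longrightarrow> b \<in> A \<Longrightarrow> \<phi> (a + b) = \<phi> a + \<phi> b"
    "a \<in> A \<Longrightarrow> b \<in> A \<Longrightarrow> \<phi> (a * b) = \<phi> a * \<phi> b"
  using assms by (auto simp: subring_of_type_def Ring.ring_hom_def)

text \<open>Constants and variables generate the field, so their images decide where the whole image
  lies: first for polynomials by \<open>mpol_induct\<close>, then for quotients.\<close>

lemma hom_ratfuns_mem:
  assumes "subfield_type L"
    and hom: "\<phi> \<in> Ring.ring_hom (subring_of_type (ratfuns V)) (subring_of_type B)"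
    and const: "\<And>c. \<phi> (rconst c) \<in> L" and var: "\<And>v. v \<in> V \<Longrightarrow> \<phi> (rvar v) \<in> L"
    and f: "f \<in> ratfuns V"
  shows "\<phi> f \<in> L"
proof -
  interpret subfield_type L by fact
  note hom = ring_hom_subring_of_typeD[OF hom]
  \<comment> \<open>Membership in the domain is carried along because \<open>\<phi>\<close> respects
    the operations only there.\<close>
  have *: "Fract p 1 \<in> ratfuns V \<and> \<phi> (Fract p 1) \<in> L" if "mpol_vars p \<subseteq> V" for p
    using that
  proof (induction rule: mpol_induct)
    case (const c)
    then show ?case
      using assms(3) rconst_mem_ratfuns by (simp flip: rconst_def)
  next
    case (var v)
    then show ?case
      using assms(4) rvar_mem_ratfuns by (simp del: One_nat_def flip: rvar_def)
  next
    case (add p q)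
    have "Fract (p + q) 1 = Fract p 1 + Fract q 1"
      by simp
    then show ?case
      using add by (simp add: hom(3) add_mem ratfuns.add_mem del: add_fract)
  next
    case (mult p q)
    have "Fract (p * q) 1 = Fract p 1 * Fract q 1"
      by simp
    then show ?case
      using mult by (simp add: hom(4) mult_mem ratfuns.mult_mem del: mult_fract)
  qed
  obtain p q where pq: "f = Fract p q" "q \<noteq> 0" "mpol_vars p \<subseteq> V" "mpol_vars q \<subseteq> V"
    using f by (rule ratfunsE)
  \<comment> \<open>Units go to units, so the image of the denominator is nonzero.\<close>
  have "Fract q 1 * Fract 1 q = 1"
    using pq(2) by (simp add: One_fract_def eq_fract)
  then have "\<phi> (Fract q 1) * \<phi> (Fract 1 q) = 1"
    using hom(2) hom(4)[of "Fract q 1" "Fract 1 q"] *[OF pq(4)] ratfunsI[of q 1 V] pq(2,4)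
    by (metis empty_subsetI mpol_vars_1)
  then have nz: "\<phi> (Fract q 1) \<noteq> 0"
    by auto
  have "Fract q 1 * f = Fract p 1"
    using pq(2) by (simp add: pq(1) eq_fract)
  then have "\<phi> (Fract q 1) * \<phi> f = \<phi> (Fract p 1)"
    using hom(4)[of "Fract q 1" f] *[OF pq(4)] f by simp
  then have "\<phi> f = \<phi> (Fract p 1) / \<phi> (Fract q 1)"
    using nz by (simp add: field_simps)
  then show ?thesis
    using *[OF pq(3)] *[OF pq(4)] by (simp add: divide_mem)
qed

section \<open>The equations of the transformed system\<close>

text \<open>Every element of the field is a quotient of two differential polynomials, so clearing a
  denominator is possible exactly for its elements.\<close>

lemma is_AODE_iff:
  "is_AODE n E \<longleftrightarrow> fst E - snd E \<in> to_ac ` ratfuns ({Indep} \<union> unknowns_derivs n)"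
    (is "_ \<longleftrightarrow> ?t \<in> to_ac ` ratfuns ?W")
proof
  assume "is_AODE n E"
  then obtain d g where dg: "d \<in> diff_polys n" "d \<noteq> 0" "g \<in> diff_polys n" "to_ac d * ?t = to_ac g"
    by (auto simp: is_AODE_def)
  have "diff_polys n \<subseteq> ratfuns ?W"
    by (auto simp: diff_polys_def intro!: ratfunsI)
  then have "g / d \<in> ratfuns ?W"
    using dg by (intro ratfuns.divide_mem) auto
  moreover have "?t = to_ac (g / d)"
    using dg(2) by (simp flip: dg(4))
  ultimately show "?t \<in> to_ac ` ratfuns ?W"
    by blast
next
  assume "?t \<in> to_ac ` ratfuns ?W"
  then obtain f where f: "f \<in> ratfuns ?W" "?t = to_ac f"
    by blast
  obtain p q where pq: "f = Fract p q" "q \<noteq> 0" "mpol_vars p \<subseteq> ?W" "mpol_vars q \<subseteq> ?W"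
    using f(1) by (rule ratfunsE)
  have "Fract g 1 \<in> diff_polys n" if "mpol_vars g \<subseteq> ?W" for g
    unfolding diff_polys_def using that by (intro CollectI exI[of _ g] exI[of _ 1]) simp
  then have "Fract q 1 \<in> diff_polys n" "Fract p 1 \<in> diff_polys n"
    using pq by blast+
  moreover have "Fract q 1 \<noteq> 0" "Fract q 1 * f = Fract p 1"
    using pq(2) by (auto simp: pq(1) Zero_fract_def eq_fract)
  ultimately show "is_AODE n E"
    unfolding is_AODE_def f(2) by (metis image_eqI to_ac_mult)
qed

lemma chain_rule_rhs_mem:
  assumes "f \<in> ratfuns (unknowns n)"
  shows "chain_rule_rhs n f \<in> ratfuns (unknowns_derivs n)"
proof -
  have "unknowns n \<subseteq> unknowns_derivs n"
    by (auto simp: unknowns_def unknowns_derivs_def)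
  then have "ratfun_pderiv v f \<in> ratfuns (unknowns_derivs n)" for v
    using ratfun_pderiv_mem_ratfuns[OF assms] ratfuns_mono by blast
  moreover have "rvar (Unk q 1) \<in> ratfuns (unknowns_derivs n)" if "q \<in> {1..n}" for q
    using that by (intro rvar_mem_ratfuns) (auto simp: unknowns_derivs_def)
  ultimately show ?thesis
    unfolding chain_rule_rhs_def by (intro ratfuns.sum_mem ratfuns.mult_mem)
qed

text \<open>The position falls into the \<open>i\<close>-th block, of length
  \<open>\<nu> i + 1\<close>, and the first \<open>i\<close> blocks end no later than all
  \<open>l\<close> of them.\<close>

lemma zpos_mem:
  assumes "i \<in> {1..l}" "j \<le> \<nu> i"
  shows "zpos \<nu> i j \<in> {1..(\<Sum>i\<in>{1..l}. \<nu> i) + l}"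
proof -
  have "zpos \<nu> i j \<le> (\<Sum>k\<in>{1..<i}. \<nu> k + 1) + (\<nu> i + 1)"
    using assms(2) by (simp add: zpos_def)
  also have "\<dots> = (\<Sum>k\<in>{1..i}. \<nu> k + 1)"
  proof -
    have "{1..i} = insert i {1..<i}"
      using assms(1) by auto
    then show ?thesis
      by simp
  qed
  also have "\<dots> \<le> (\<Sum>k\<in>{1..l}. \<nu> k + 1)"
    using assms(1) by (intro sum_mono2) auto
  also have "\<dots> = (\<Sum>k\<in>{1..l}. \<nu> k) + l"
    by (simp only: sum.distrib sum_constant card_atLeastAtMost) simp
  finally show ?thesis
    by (simp add: zpos_def)
qed

lemma radical_tower_mono:
  assumes "radical_tower K m FF \<delta> e" "i \<le> m"
  shows "K \<subseteq> FF i"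
  using assms(2)
proof (induction i)
  case 0
  then show ?case
    using assms(1) by (simp add: radical_tower_def)
next
  case (Suc i)
  then have "FF (Suc i) = generate_field univ_ring (FF i \<union> {\<delta> (Suc i)})"
    using assms(1) unfolding radical_tower_def by force
  then show ?case
    using Suc by (auto intro: generate_field.incl)
qed

theorem theorem3p4:
  fixes n l m N :: nat and \<nu> e :: "nat \<Rightarrow> nat"
    and \<iota> :: "nat ratfun \<Rightarrow> 'k::field"
    and FF :: "nat \<Rightarrow> 'k set" and \<delta> :: "nat \<Rightarrow> 'k"
    and F :: "nat \<Rightarrow> 'k poly" and H :: "'k list"
    and r :: "nat \<Rightarrow> dvar ratfun" and \<sigma> :: "'k \<Rightarrow> dexpr"
  assumes n: "n = (\<Sum>i\<in>{1..l}. \<nu> i) + l"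
    and embedding: "\<iota> \<in> Ring.ring_hom (subring_of_type (ratfuns {1..n})) ring_of_type_algebra"
    and tower: "radical_tower (\<iota> ` ratfuns {1..n}) m FF \<delta> e"
    and coeffs_F: "\<And>k i. k \<in> {1..N} \<Longrightarrow> Polynomial.coeff (F k) i \<in> FF m"
    and change: "rational_change n r"
    and branch_hom: "\<sigma> \<in> Ring.ring_hom (subring_of_type (FF m))
                      (subring_of_type (algebraic_over (to_ac ` ratfuns (unknowns n))))"
    and branch_const: "\<And>c. \<sigma> (\<iota> (rconst c)) = to_ac (rconst c)"
    and branch_var: "\<And>p. p \<in> {1..n} \<Longrightarrow> \<sigma> (\<iota> (rvar p)) = to_ac (r p)"
    and H: "set H = {Polynomial.coeff (F k) i | k i. k \<in> {1..N}} - \<iota> ` ratfuns {1..n}"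
  shows "is_AODE_system n (transformed_system n l \<nu> N \<sigma> r F) \<longleftrightarrow>
         (\<forall>h\<in>set (map \<sigma> H). h \<in> to_ac ` ratfuns (unknowns n))"
proof -
  let ?L = "to_ac ` ratfuns (unknowns n)"
  let ?W = "{Indep} \<union> unknowns_derivs n"
  let ?G = "\<lambda>k. map_poly \<sigma> (F k)"
  note \<iota> = ring_hom_subring_of_typeD[OF embedding[folded subring_of_type_UNIV]]
  note \<sigma> = ring_hom_subring_of_typeD[OF branch_hom]
  have r: "r p \<in> ratfuns (unknowns n)" if "p \<in> {1..n}" for p
    using change that by (simp add: rational_change_def)
  have tower_sub: "\<iota> f \<in> FF m" if "f \<in> ratfuns {1..n}" for f
    using radical_tower_mono[OF tower order.refl] that by blast
  \<comment> \<open>The homomorphism laws name only 1, sums and products; 0 is obtained by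
    cancellation in \<open>\<iota> 0 = \<iota> 0 + \<iota> 0\<close>.\<close>
  have "\<iota> 0 = 0"
    using \<iota>(3)[OF ratfuns.zero_mem ratfuns.zero_mem] by (metis add_0 add_cancel_right_right)
  then have "0 \<in> FF m"
    using tower_sub[OF ratfuns.zero_mem] by simp
  then have \<sigma>0: "\<sigma> 0 = 0"
    using \<sigma>(3)[of 0 0] by simp
  \<comment> \<open>\<open>map_poly\<close> acts coefficientwise beyond the degree as well only
    because \<open>\<sigma> 0 = 0\<close>.\<close>
  have coeff_G: "Polynomial.coeff (?G k) i = \<sigma> (Polynomial.coeff (F k) i)" for k i
    by (simp add: coeff_map_poly \<sigma>0)
  \<comment> \<open>On rational functions of z the composition is the substitution z = r(w), which
    sends the generators into \<open>?L\<close>.\<close>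
  have "\<sigma> \<circ> \<iota> \<in> Ring.ring_hom (subring_of_type (ratfuns {1..n})) (subring_of_type UNIV)"
    using \<iota> \<sigma> tower_sub by (auto simp: Ring.ring_hom_def subring_of_type_def)
  then have rational: "\<sigma> (\<iota> f) \<in> ?L" if "f \<in> ratfuns {1..n}" for f
    using hom_ratfuns_mem[OF ratfuns_ac.subfield_type_axioms, of "\<sigma> \<circ> \<iota>" "{1..n}" UNIV "unknowns n" f]
      that r by (auto simp: branch_const branch_var rconst_mem_ratfuns)

  have sub: "unknowns n \<subseteq> ?W"
    by (auto simp: unknowns_def unknowns_derivs_def)
  \<comment> \<open>Since \<open>j < \<nu> i\<close>, both \<open>j\<close> and \<open>j + 1\<close>
    index components in block \<open>i\<close>, so both sides are rational.\<close>
  have order_eqns: "is_AODE n (to_ac (r (zpos \<nu> i (j + 1))), to_ac (chain_rule_rhs n (r (zpos \<nu> i j))))"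
    if "i \<in> {1..l}" "j < \<nu> i" for i j
  proof -
    have "r (zpos \<nu> i (j + 1)) \<in> ratfuns ?W"
      using r[of "zpos \<nu> i (j + 1)"] zpos_mem[of i l "j + 1" \<nu>] that n ratfuns_mono[OF sub] by auto
    moreover have "chain_rule_rhs n (r (zpos \<nu> i j)) \<in> ratfuns ?W"
      using chain_rule_rhs_mem[OF r[of "zpos \<nu> i j"]] zpos_mem[of i l j \<nu>] that n
        ratfuns_mono[of "unknowns_derivs n" ?W] by auto
    ultimately show ?thesis
      by (auto simp: is_AODE_iff simp flip: to_ac_diff intro!: ratfuns.diff_mem)
  qed
  have "is_AODE n (transformed_eqn \<sigma> (F k), 0) \<longleftrightarrow> (\<forall>i. Polynomial.coeff (?G k) i \<in> ?L)"
    if k: "k \<in> {1..N}" for k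
  proof
    assume "is_AODE n (transformed_eqn \<sigma> (F k), 0)"
    \<comment> \<open>Rationality in any variables suffices here; algebraicity of the coefficients
      over \<open>?L\<close> excludes the derivatives of the unknowns.\<close>
    then have "Polynomial.poly (?G k) (to_ac (rvar Indep)) \<in> range to_ac"
      by (auto simp: is_AODE_iff transformed_eqn_def)
    moreover have "Indep \<notin> unknowns n"
      by (simp add: unknowns_def)
    moreover have "Polynomial.coeff (?G k) i \<in> algebraic_over ?L" for i
      unfolding coeff_G by (intro \<sigma>(1) coeffs_F k)
    ultimately show "\<forall>i. Polynomial.coeff (?G k) i \<in> ?L"
      using coeff_rational_if_value_rational by blast
  next
    assume "\<forall>i. Polynomial.coeff (?G k) i \<in> ?L"
    then have "Polynomial.poly (?G k) (to_ac (rvar Indep)) \<in> to_ac ` ratfuns ?W"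
      using ratfuns_mono[OF sub] by (intro ratfuns_ac.poly_mem imageI rvar_mem_ratfuns) auto
    then show "is_AODE n (transformed_eqn \<sigma> (F k), 0)"
      by (simp add: is_AODE_iff transformed_eqn_def)
  qed
  then have "is_AODE_system n (transformed_system n l \<nu> N \<sigma> r F) \<longleftrightarrow>
      (\<forall>k\<in>{1..N}. \<forall>i. \<sigma> (Polynomial.coeff (F k) i) \<in> ?L)"
    using order_eqns unfolding is_AODE_system_def transformed_system_def coeff_G by blast
  also have "\<dots> \<longleftrightarrow> (\<forall>h\<in>set (map \<sigma> H). h \<in> ?L)"
  proof (intro iffI ballI allI)
    fix h assume all: "\<forall>k\<in>{1..N}. \<forall>i. \<sigma> (Polynomial.coeff (F k) i) \<in> ?L"
      and "h \<in> set (map \<sigma> H)"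
    then obtain k i where "k \<in> {1..N}" "h = \<sigma> (Polynomial.coeff (F k) i)"
      unfolding set_map H by blast
    with all show "h \<in> ?L"
      by simp
  next
    fix k i assume all: "\<forall>h\<in>set (map \<sigma> H). h \<in> ?L" and k: "k \<in> {1..N}"
    show "\<sigma> (Polynomial.coeff (F k) i) \<in> ?L"
    \<comment> \<open>Coefficients missing from \<open>H\<close> are rational in z and remain
      rational under the substitution.\<close>
    proof (cases "Polynomial.coeff (F k) i \<in> \<iota> ` ratfuns {1..n}")
      case True
      then show ?thesis
        using rational by auto
    next
      case False
      then have "Polynomial.coeff (F k) i \<in> set H"
        unfolding H using k by blast
      with all show ?thesis
        by simp
    qed
  qed
  finally show ?thesis .
qed

end
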